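(* (Primal version.) If there exists $x\in\operatorname{ri}(C)$ with $b-A(x)\in\operatorname{ri}(K)$ (primal Slater constraint qualification), then the set $$\{(A^*(y)-w,\ \langle b,y\rangle)\ :\ y\in K^*,\ w\in C^*\}\subseteq E\times\mathbb{R}$$ is closed, and consequently strong duality holds between (P) and (D). (Dual version.) If there exists $y\in\operatorname{ri}(K^* )$ with $A^*(y)-c\in\operatorname{ri}(C^* )$ (dual Slater constraint qualification), then the set $$\{(A(x)+s,\ \langle c,x\rangle)\ :\ x\in C,\ s\in K\}\subseteq E'\times\mathbb{R}$$ is closed, and consequently strong duality holds between (P) and (D).
   Context: $E,E'$ are finite-dimensional real inner-product spaces; $C\subseteq E$ and $K\subseteq E'$ are nonempty closed convex cones (so they contain the origin), with $C\neq\{0\}$ and with $C\neq E$ or $K\neq E'$; $A:E\to E'$ is linear with adjoint $A^*:E'\to E$; $b\in E'$, $c\in E$. For a cone $D$, $D^*=\{y:\langle x,y\rangle\ge 0\ \forall x\in D\}$ is its dual cone; $\operatorname{ri}$ denotes relative interior. The primal conic program is (P): $z_P^*=\sup\{\langle c,x\rangle : b-A(x)\in K,\ x\in C\}$ and its dual is (D): $z_D^*=\inf\{\langle b,y\rangle : A^*(y)-c\in C^*,\ y\in K^*\}$. Usual conventions: supremum over the empty set is $-\infty$, infimum over the empty set is $+\infty$. Strong duality means that $z_P^*=z_D^*$ (values $\pm\infty$ allowed) and, if these values are finite, at least one of the two problems has an optimal solution. *)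

theory Defs
  imports "HOL-Analysis.Analysis"
begin

(* The class euclidean_space would exclude the zero space, which is allowed for the codomain of A. *)
definition finite_dimensional :: "'a::real_inner itself \<Rightarrow> bool" where
  "finite_dimensional (_ :: 'a itself) \<longleftrightarrow> (\<exists>B :: 'a set. finite B \<and> span B = UNIV)"

definition dual_cone :: "'a::real_inner set \<Rightarrow> 'a set" where
  "dual_cone D = {y. \<forall>x\<in>D. x \<bullet> y \<ge> 0}"

definition primal_feasible ::
  "'a::real_inner set \<Rightarrow> 'b::real_inner set \<Rightarrow> ('a \<Rightarrow> 'b) \<Rightarrow> 'b \<Rightarrow> 'a set" where
  "primal_feasible C K A b = {x. b - A x \<in> K \<and> x \<in> C}"

definition dual_feasible ::
  "'a::real_inner set \<Rightarrow> 'b::real_inner set \<Rightarrow> ('a \<Rightarrow> 'b) \<Rightarrow> 'a \<Rightarrow> 'b set" where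
  "dual_feasible C K A c = {y. adjoint A y - c \<in> dual_cone C \<and> y \<in> dual_cone K}"

definition primal_value ::
  "'a::real_inner set \<Rightarrow> 'b::real_inner set \<Rightarrow> ('a \<Rightarrow> 'b) \<Rightarrow> 'b \<Rightarrow> 'a \<Rightarrow> ereal" where
  "primal_value C K A b c = (SUP x\<in>primal_feasible C K A b. ereal (c \<bullet> x))"

definition dual_value ::
  "'a::real_inner set \<Rightarrow> 'b::real_inner set \<Rightarrow> ('a \<Rightarrow> 'b) \<Rightarrow> 'b \<Rightarrow> 'a \<Rightarrow> ereal" where
  "dual_value C K A b c = (INF y\<in>dual_feasible C K A c. ereal (b \<bullet> y))"

definition primal_optimal ::
  "'a::real_inner set \<Rightarrow> 'b::real_inner set \<Rightarrow> ('a \<Rightarrow> 'b) \<Rightarrow> 'b \<Rightarrow> 'a \<Rightarrow> 'a \<Rightarrow> bool" where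
  "primal_optimal C K A b c x \<longleftrightarrow>
     x \<in> primal_feasible C K A b \<and> (\<forall>x'\<in>primal_feasible C K A b. c \<bullet> x' \<le> c \<bullet> x)"

definition dual_optimal ::
  "'a::real_inner set \<Rightarrow> 'b::real_inner set \<Rightarrow> ('a \<Rightarrow> 'b) \<Rightarrow> 'b \<Rightarrow> 'a \<Rightarrow> 'b \<Rightarrow> bool" where
  "dual_optimal C K A b c y \<longleftrightarrow>
     y \<in> dual_feasible C K A c \<and> (\<forall>y'\<in>dual_feasible C K A c. b \<bullet> y \<le> b \<bullet> y')"

definition strong_duality ::
  "'a::real_inner set \<Rightarrow> 'b::real_inner set \<Rightarrow> ('a \<Rightarrow> 'b) \<Rightarrow> 'b \<Rightarrow> 'a \<Rightarrow> bool" where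
  "strong_duality C K A b c \<longleftrightarrow>
     primal_value C K A b c = dual_value C K A b c \<and>
     (\<bar>primal_value C K A b c\<bar> \<noteq> \<infinity> \<longrightarrow>
        (\<exists>x. primal_optimal C K A b c x) \<or> (\<exists>y. dual_optimal C K A b c y))"

end

theory Submission
  imports Defs
begin

text \<open>
Write \<open>A\<^sup>*\<close> for the adjoint of \<open>A\<close>. The set in the primal version is the image of the closed convex
cone \<open>K\<^sup>* \<times> C\<^sup>*\<close> under the linear map \<open>(y, w) \<mapsto> (A\<^sup>* y - w, \<langle>b, y\<rangle>)\<close>. A linear image of a closed
convex cone can fail to be closed only because the cone contains a direction that the map kills
and whose negative is not in the cone (\<open>closed_linear_image_cone\<close>). A Slater point \<open>x\<^sub>0\<close> excludes
such directions: if \<open>A\<^sup>* y = w\<close> and \<open>\<langle>b, y\<rangle> = 0\<close>, then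
\<open>0 = \<langle>b - A x\<^sub>0, y\<rangle> + \<langle>x\<^sub>0, w\<rangle>\<close> is a sum of nonnegative numbers, so both vanish, and an element of a
dual cone that is orthogonal to a point of the relative interior is orthogonal to the whole cone
(\<open>dual_cone_orthogonal_rel_interior\<close>); hence \<open>-y \<in> K\<^sup>*\<close> and \<open>-w \<in> C\<^sup>*\<close>.

For strong duality the same argument is applied to the larger set \<open>T\<close> of all
\<open>(A\<^sup>* y - w, \<langle>b, y\<rangle> + t)\<close> with \<open>t \<ge> 0\<close>. A bound \<open>z\<close> of the primal objective is matched by some dual
feasible \<open>y\<close> with \<open>\<langle>b, y\<rangle> \<le> z\<close> exactly if \<open>(c, z) \<in> T\<close>. Otherwise a hyperplane separates \<open>(c, z)\<close>
from the closed cone \<open>T\<close>, and by the bipolar theorem its normal vector is a pair \<open>(-x, r)\<close> with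
\<open>r \<ge> 0\<close>, \<open>x \<in> C\<close>, \<open>r b - A x \<in> K\<close> and \<open>\<langle>c, x\<rangle> > r z\<close>. For \<open>r > 0\<close> the point \<open>x / r\<close>, and for
\<open>r = 0\<close> a point far out on the ray from \<open>x\<^sub>0\<close> in direction \<open>x\<close>, is feasible and exceeds the bound.

The dual version is the primal version for the cones \<open>K\<^sup>*\<close> and \<open>C\<^sup>*\<close>, the map \<open>-A\<^sup>*\<close> and the
vectors \<open>-c\<close> and \<open>-b\<close> (\<open>swap_primal_dual\<close>), because \<open>C\<^sup>*\<^sup>* = C\<close> and \<open>K\<^sup>*\<^sup>* = K\<close>.
\<close>

section \<open>Finite-dimensional inner-product spaces\<close>

text \<open>
An orthonormal basis gives the coordinates through which compactness of closed bounded sets,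
continuity of linear maps and existence of the adjoint are reduced to the real line.
\<close>
lemma orthonormal_basis_finite_dimensional:
  assumes "finite_dimensional TYPE('a::real_inner)"
  obtains B :: "'a::real_inner set" where "finite B"
    "\<And>x y. \<lbrakk>x \<in> B; y \<in> B\<rbrakk> \<Longrightarrow> x \<bullet> y = (if x = y then 1 else 0)"
    "\<And>x. (\<Sum>e\<in>B. (x \<bullet> e) *\<^sub>R e) = x"
proof -
  obtain D :: "'a set" where D: "finite D" "span D = UNIV" "pairwise orthogonal D"
    using assms basis_orthogonal unfolding finite_dimensional_def by metis
  define B where "B = (\<lambda>x. x /\<^sub>R norm x) ` (D - {0})"
  have fin: "finite B"
    using D(1) by (simp add: B_def)
  have on: "x \<bullet> y = (if x = y then 1 else 0)" if xy: "x \<in> B" "y \<in> B" for x y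
  proof -
    obtain u v where uv: "u \<in> D" "v \<in> D" "u \<noteq> 0" "v \<noteq> 0" "x = u /\<^sub>R norm u" "y = v /\<^sub>R norm v"
      using xy unfolding B_def by blast
    show ?thesis
    proof (cases "x = y")
      case True
      with uv show ?thesis by (simp add: dot_square_norm power2_eq_square)
    next
      case False
      with uv D(3) have "u \<bullet> v = 0"
        by (auto simp: pairwise_def orthogonal_def)
      with False uv show ?thesis by simp
    qed
  qed
  \<comment> \<open>\<open>B\<close> spans, so a vector minus its expansion in \<open>B\<close> is orthogonal to itself.\<close>
  have "D \<subseteq> span B"
  proof
    fix d assume "d \<in> D"
    show "d \<in> span B"
    proof (cases "d = 0")
      case False
      with \<open>d \<in> D\<close> have "norm d *\<^sub>R (d /\<^sub>R norm d) \<in> span B"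
        by (intro span_mul span_base) (auto simp: B_def)
      with False show ?thesis by simp
    qed (simp add: span_zero)
  qed
  then have spanB: "span B = UNIV"
    using D(2) span_mono[of D "span B"] by (simp add: span_span top.extremum_unique)
  have "(\<Sum>e\<in>B. (x \<bullet> e) *\<^sub>R e) = x" for x
  proof -
    define z where "z = x - (\<Sum>e\<in>B. (x \<bullet> e) *\<^sub>R e)"
    have "orthogonal z e" if "e \<in> B" for e
    proof -
      have "(\<Sum>f\<in>B. (x \<bullet> f) * (f \<bullet> e)) = (\<Sum>f\<in>B. if f = e then x \<bullet> f else 0)"
        using on that by (intro sum.cong) auto
      with fin that show ?thesis
        by (simp add: z_def orthogonal_def inner_diff_left inner_sum_left)
    qed
    then have "orthogonal z z"
      using orthogonal_to_span[of z B z] spanB by auto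
    then show ?thesis
      by (simp add: z_def orthogonal_def)
  qed
  with fin on show thesis by (rule that)
qed

lemma finite_dimensional_real: "finite_dimensional TYPE(real)"
proof -
  have "x \<in> span {1}" for x :: real
    using span_mul[OF span_base[of 1 "{1::real}"], of x] by (simp add: real_scaleR_def)
  then show ?thesis
    unfolding finite_dimensional_def by (intro exI[of _ "{1}"]) auto
qed

lemma finite_dimensional_prod:
  assumes "finite_dimensional TYPE('a::real_inner)" "finite_dimensional TYPE('b::real_inner)"
  shows "finite_dimensional TYPE('a \<times> 'b)"
proof -
  obtain S :: "'a set" and T :: "'b set"
    where ST: "finite S" "span S = UNIV" "finite T" "span T = UNIV"
    using assms unfolding finite_dimensional_def by auto
  let ?U = "(\<lambda>x. (x, 0)) ` S \<union> (\<lambda>y. (0, y)) ` T"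
  have l: "linear (\<lambda>x::'a. (x, 0::'b))" "linear (\<lambda>y::'b. (0::'a, y))"
    by (auto intro!: linearI)
  have "(x, y) \<in> span ?U" for x y
  proof -
    have "(x, 0) \<in> span ?U"
      using linear_span_image[OF l(1), of S] span_mono[of "(\<lambda>x. (x, 0)) ` S" ?U] ST by auto
    moreover have "(0, y) \<in> span ?U"
      using linear_span_image[OF l(2), of T] span_mono[of "(\<lambda>x. (0, x)) ` T" ?U] ST by auto
    ultimately show ?thesis
      using span_add[of "(x, 0)" ?U "(0, y)"] by simp
  qed
  with ST show ?thesis
    unfolding finite_dimensional_def by (intro exI[of _ ?U]) auto
qed

lemma compact_finite_dimensional:
  fixes S :: "'a::real_inner set"
  assumes fd: "finite_dimensional TYPE('a)" and "closed S" "bounded S"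
  shows "compact S"
  unfolding compact_def
proof (intro allI impI)
  fix f :: "nat \<Rightarrow> 'a"
  assume fS: "\<forall>n. f n \<in> S"
  obtain B :: "'a set" where B: "finite B"
    "\<And>x y. \<lbrakk>x \<in> B; y \<in> B\<rbrakk> \<Longrightarrow> x \<bullet> y = (if x = y then 1 else 0)"
    "\<And>x. (\<Sum>e\<in>B. (x \<bullet> e) *\<^sub>R e) = x"
    using orthonormal_basis_finite_dimensional[OF fd] by blast
  have "bounded (range f)"
    using fS by (intro bounded_subset[OF \<open>bounded S\<close>]) auto
  then have bd: "bounded ((\<lambda>x. x \<bullet> k) ` range f)" for k
    by (intro bounded_linear_image bounded_linear_inner_left)
  have proj: "(\<Sum>e\<in>B. g e *\<^sub>R e) \<bullet> k = g k" if "k \<in> B" for k and g :: "'a \<Rightarrow> real"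
  proof -
    have "(\<Sum>e\<in>B. g e * (e \<bullet> k)) = (\<Sum>e\<in>B. if e = k then g e else 0)"
      using B(2) that by (intro sum.cong) auto
    with B(1) that show ?thesis by (simp add: inner_sum_left)
  qed
  obtain l r where r: "strict_mono (r :: nat \<Rightarrow> nat)" and
    l: "\<And>\<epsilon>. \<epsilon> > 0 \<Longrightarrow> \<forall>\<^sub>F n in sequentially. \<forall>i\<in>B. dist (f (r n) \<bullet> i) (l \<bullet> i) < \<epsilon>"
    using compact_lemma_general[where f = f and basis = B and proj = "\<lambda>x k. x \<bullet> k"
        and unproj = "\<lambda>g. \<Sum>e\<in>B. g e *\<^sub>R e", OF B(1) bd proj B(3)]
    by blast
  have "(\<lambda>n. f (r n) \<bullet> i) \<longlonglongrightarrow> l \<bullet> i" if "i \<in> B" for i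
    unfolding tendsto_iff
  proof (intro allI impI)
    fix e :: real assume "e > 0"
    from l[OF this] show "\<forall>\<^sub>F n in sequentially. dist (f (r n) \<bullet> i) (l \<bullet> i) < e"
      by (rule eventually_mono) (use that in blast)
  qed
  then have "(\<lambda>n. \<Sum>e\<in>B. (f (r n) \<bullet> e) *\<^sub>R e) \<longlonglongrightarrow> (\<Sum>e\<in>B. (l \<bullet> e) *\<^sub>R e)"
    by (intro tendsto_sum tendsto_scaleR tendsto_const)
  then have lim: "(f \<circ> r) \<longlonglongrightarrow> l"
    by (simp add: B(3) o_def)
  then have "l \<in> S"
    using closed_sequentially[OF \<open>closed S\<close>, of "f \<circ> r" l] fS by auto
  with r lim show "\<exists>l\<in>S. \<exists>r. strict_mono r \<and> (f \<circ> r) \<longlonglongrightarrow> l"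
    by blast
qed

lemma linear_isCont_finite_dimensional:
  fixes f :: "'a::real_inner \<Rightarrow> 'b::real_normed_vector"
  assumes fd: "finite_dimensional TYPE('a)" and "linear f"
  shows "isCont f x"
proof -
  interpret linear f by fact
  obtain B :: "'a set" where B: "\<And>x. (\<Sum>e\<in>B. (x \<bullet> e) *\<^sub>R e) = x"
    using orthonormal_basis_finite_dimensional[OF fd] by metis
  define g where "g x = (\<Sum>e\<in>B. (x \<bullet> e) *\<^sub>R f e)" for x
  have "f = g"
  proof
    fix x
    have "f x = f (\<Sum>e\<in>B. (x \<bullet> e) *\<^sub>R e)" by (simp add: B)
    then show "f x = g x" by (simp add: sum scale g_def)
  qed
  moreover have "isCont g x"
    unfolding g_def by (intro continuous_intros)
  ultimately show ?thesis by simp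
qed

text \<open>
The adjoint is specified by a choice operator, so this identity is available only after a map
with the required property has been exhibited; an orthonormal basis provides its coordinates.
\<close>
lemma inner_adjoint_finite_dimensional:
  fixes f :: "'a::real_inner \<Rightarrow> 'b::real_inner"
  assumes fd: "finite_dimensional TYPE('a)" and "linear f"
  shows "x \<bullet> adjoint f y = f x \<bullet> y"
proof -
  interpret linear f by fact
  obtain B :: "'a set" where B: "\<And>x. (\<Sum>e\<in>B. (x \<bullet> e) *\<^sub>R e) = x"
    using orthonormal_basis_finite_dimensional[OF fd] by metis
  define g where "g y = (\<Sum>e\<in>B. (f e \<bullet> y) *\<^sub>R e)" for y
  have g: "f x \<bullet> y = x \<bullet> g y" for x y
  proof -
    have "f x \<bullet> y = f (\<Sum>e\<in>B. (x \<bullet> e) *\<^sub>R e) \<bullet> y" by (simp add: B)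
    also have "\<dots> = (\<Sum>e\<in>B. (x \<bullet> e) * (f e \<bullet> y))"
      by (simp add: sum scale inner_sum_left)
    finally show ?thesis by (simp add: g_def inner_sum_right mult.commute)
  qed
  then have "adjoint f = g"
    by (intro adjoint_unique) auto
  with g show ?thesis by simp
qed

lemma linear_adjoint_finite_dimensional:
  fixes f :: "'a::real_inner \<Rightarrow> 'b::real_inner"
  assumes "finite_dimensional TYPE('a)" and "linear f"
  shows "linear (adjoint f)"
proof (rule linearI)
  note adj = inner_adjoint_finite_dimensional[OF assms]
  fix y z and r :: real
  have "\<forall>x. x \<bullet> adjoint f (y + z) = x \<bullet> (adjoint f y + adjoint f z)"
    by (simp add: adj inner_add_right)
  then show "adjoint f (y + z) = adjoint f y + adjoint f z"
    by (metis vector_eq_ldot)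
  have "\<forall>x. x \<bullet> adjoint f (r *\<^sub>R y) = x \<bullet> (r *\<^sub>R adjoint f y)"
    by (simp add: adj)
  then show "adjoint f (r *\<^sub>R y) = r *\<^sub>R adjoint f y"
    by (metis vector_eq_ldot)
qed


section \<open>Linear images of closed convex cones\<close>

text \<open>
If preimages in the cone could not be kept bounded, then nearly shortest preimages, rescaled to
unit length, would accumulate at some \<open>l \<in> N\<close> in the kernel. By hypothesis also \<open>- l \<in> N\<close>, so
multiples of \<open>l\<close> can be subtracted without leaving the fibre or the cone, and this makes some of
these preimages much shorter, a contradiction.
\<close>
lemma bounded_preimage_in_cone:
  fixes M :: "'a::real_inner \<Rightarrow> 'b::real_normed_vector"
  assumes fd: "finite_dimensional TYPE('a)" and "linear M"
    and "convex_cone N" "closed N"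
    and ker: "\<And>v. \<lbrakk>v \<in> N; M v = 0\<rbrakk> \<Longrightarrow> - v \<in> N"
  shows "\<exists>\<beta>. \<forall>v\<in>N. norm (M v) \<le> \<rho> \<longrightarrow> (\<exists>w\<in>N. M w = M v \<and> norm w \<le> \<beta>)"
proof (rule ccontr)
  interpret linear M by fact
  assume "\<not> ?thesis"
  then have bad: "\<exists>v\<in>N. norm (M v) \<le> \<rho> \<and> (\<forall>w\<in>N. M w = M v \<longrightarrow> \<beta> < norm w)" for \<beta>
    by (meson not_le)
  \<comment> \<open>Being shortest up to an additive 1 is enough below, and needs only an infimum.\<close>
  have "\<exists>v\<in>N. norm (M v) \<le> \<rho> \<and> real n < norm v \<and>
      (\<forall>w\<in>N. M w = M v \<longrightarrow> norm v \<le> norm w + 1)" for n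
  proof -
    obtain v where v: "v \<in> N" "norm (M v) \<le> \<rho>" "\<And>w. \<lbrakk>w \<in> N; M w = M v\<rbrakk> \<Longrightarrow> real n < norm w"
      using bad by blast
    let ?F = "norm ` {w \<in> N. M w = M v}"
    have bb: "bdd_below ?F" by (rule bdd_belowI[of _ 0]) auto
    have "Inf ?F < Inf ?F + 1" by simp
    then obtain w where w: "w \<in> N" "M w = M v" "norm w < Inf ?F + 1"
      using cInf_lessD[of ?F "Inf ?F + 1"] v(1) by auto
    have "norm w \<le> norm w' + 1" if "w' \<in> N" "M w' = M w" for w'
      using cInf_lower[OF _ bb, of "norm w'"] w that by force
    moreover have "real n < norm w" using v(3) w by blast
    ultimately show ?thesis using w v by (intro bexI[of _ w]) auto
  qed
  then obtain v where v: "\<And>n. v n \<in> N" "\<And>n. norm (M (v n)) \<le> \<rho>"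
      "\<And>n. real n < norm (v n)"
      "\<And>n w. \<lbrakk>w \<in> N; M w = M (v n)\<rbrakk> \<Longrightarrow> norm (v n) \<le> norm w + 1"
    by metis
  have pos: "0 < norm (v n)" for n using v(3)[of n] by linarith
  define u where "u n = v n /\<^sub>R norm (v n)" for n
  have uN: "u n \<in> N" for n
    using v(1) \<open>convex_cone N\<close> by (simp add: u_def convex_cone_scaleR)
  have unit: "norm (u n) = 1" for n using pos[of n] by (simp add: u_def)
  have "compact (N \<inter> cball 0 1)"
    using fd \<open>closed N\<close> by (intro compact_finite_dimensional) auto
  then obtain l r where r: "strict_mono r" and lim: "(u \<circ> r) \<longlonglongrightarrow> l" and lN: "l \<in> N"
    using uN unit unfolding compact_def by (metis IntD1 IntI mem_cball_0 order_refl)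
  have "(\<lambda>n. M (u (r n))) \<longlonglongrightarrow> 0"
  proof (rule Lim_null_comparison)
    show "\<forall>\<^sub>F n in sequentially. norm (M (u (r n))) \<le> \<rho> * inverse (real n)"
      using eventually_gt_at_top[of 0]
    proof eventually_elim
      case (elim n)
      have "n \<le> r n" using r by (rule seq_suble)
      then have "inverse (norm (v (r n))) \<le> inverse (real n)"
        using elim v(3)[of "r n"] by (intro le_imp_inverse_le) auto
      moreover have "0 \<le> \<rho>" using v(2)[of 0] norm_ge_zero order_trans by blast
      ultimately have "norm (M (v (r n))) * inverse (norm (v (r n))) \<le> \<rho> * inverse (real n)"
        using v(2) by (intro mult_mono) auto
      then show ?case by (simp add: u_def scale mult.commute)
    qed
    show "(\<lambda>n. \<rho> * inverse (real n)) \<longlonglongrightarrow> 0"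
      by (intro tendsto_mult_right_zero lim_inverse_n)
  qed
  moreover have "(\<lambda>n. M (u (r n))) \<longlonglongrightarrow> M l"
    using isCont_tendsto_compose[OF linear_isCont_finite_dimensional[OF fd \<open>linear M\<close>] lim]
    by (simp add: o_def)
  ultimately have Ml: "M l = 0" using LIMSEQ_unique by blast
  have "(\<lambda>n. norm (u (r n) - l)) \<longlonglongrightarrow> 0"
    using lim by (simp add: o_def tendsto_norm_zero LIM_zero)
  then have "\<forall>\<^sub>F n in sequentially. norm (u (r n) - l) < 1/2"
    by (rule order_tendstoD) simp
  then obtain n where n: "norm (u (r n) - l) < 1/2" "2 \<le> n"
    unfolding eventually_sequentially by (meson max.cobounded1 max.cobounded2)
  \<comment> \<open>\<open>w\<close> has at most half the length \<open>t\<close> of \<open>v (r n)\<close>; as \<open>t > 2\<close>, this saves more than 1.\<close>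
  define t where "t = norm (v (r n))"
  have t: "2 < t" using seq_suble[OF r, of n] n(2) v(3)[of "r n"] by (simp add: t_def)
  define w where "w = v (r n) + t *\<^sub>R (- l)"
  have "w \<in> N"
    unfolding w_def using v(1) ker[OF lN Ml] t \<open>convex_cone N\<close>
    by (intro convex_cone_add convex_cone_scaleR) auto
  moreover have "M w = M (v (r n))" by (simp add: w_def diff scale Ml)
  ultimately have "t \<le> norm w + 1" using v(4) by (simp add: t_def)
  moreover have "w = t *\<^sub>R (u (r n) - l)"
    using pos[of "r n"] by (simp add: w_def u_def t_def scaleR_diff_right)
  then have "norm w \<le> t * (1/2)" using n(1) t by simp
  ultimately show False using t by simp
qed

text \<open>
Bounded preimages of a convergent sequence of image points have a convergent subsequence, whose
limit is a preimage of the limit point.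
\<close>
lemma closed_linear_image_cone:
  fixes M :: "'a::real_inner \<Rightarrow> 'b::real_normed_vector"
  assumes fd: "finite_dimensional TYPE('a)" and "linear M"
    and "convex_cone N" "closed N"
    and ker: "\<And>v. \<lbrakk>v \<in> N; M v = 0\<rbrakk> \<Longrightarrow> - v \<in> N"
  shows "closed (M ` N)"
  unfolding closed_sequential_limits
proof (intro allI impI)
  fix z l
  assume "(\<forall>n. z n \<in> M ` N) \<and> z \<longlonglongrightarrow> l"
  then have zN: "\<And>n. z n \<in> M ` N" and lim: "z \<longlonglongrightarrow> l" by auto
  obtain \<rho> where \<rho>: "\<And>n. norm (z n) \<le> \<rho>"
    using convergent_imp_bounded[OF lim] by (auto simp: bounded_iff)
  obtain \<beta> where \<beta>: "\<And>v. \<lbrakk>v \<in> N; norm (M v) \<le> \<rho>\<rbrakk> \<Longrightarrow> \<exists>w\<in>N. M w = M v \<and> norm w \<le> \<beta>"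
    using bounded_preimage_in_cone[OF assms] by meson
  have "\<exists>w\<in>N. M w = z n \<and> norm w \<le> \<beta>" for n
    using zN[of n] \<rho>[of n] \<beta> by fastforce
  then obtain w where w: "\<And>n. w n \<in> N \<inter> cball 0 \<beta>" "\<And>n. M (w n) = z n"
    by (metis IntI mem_cball_0)
  have "compact (N \<inter> cball 0 \<beta>)"
    using fd \<open>closed N\<close> by (intro compact_finite_dimensional) auto
  then obtain v r where "v \<in> N" and r: "strict_mono r" and v: "(w \<circ> r) \<longlonglongrightarrow> v"
    using w(1) unfolding compact_def by (metis IntD1)
  have "(\<lambda>n. M ((w \<circ> r) n)) \<longlonglongrightarrow> M v"
    by (intro isCont_tendsto_compose[OF _ v] linear_isCont_finite_dimensional fd \<open>linear M\<close>)
  moreover have "(\<lambda>n. M ((w \<circ> r) n)) \<longlonglongrightarrow> l"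
    using LIMSEQ_subseq_LIMSEQ[OF lim r] by (simp add: w o_def)
  ultimately have "l = M v" using LIMSEQ_unique by blast
  with \<open>v \<in> N\<close> show "l \<in> M ` N" by blast
qed


section \<open>Dual cones\<close>

lemma convex_cone_dual_cone: "convex_cone (dual_cone D)"
  by (auto simp: convex_cone_iff dual_cone_def inner_add_right)

lemma convex_cone_Times: "\<lbrakk>convex_cone S; convex_cone T\<rbrakk> \<Longrightarrow> convex_cone (S \<times> T)"
  by (auto simp: convex_cone_iff zero_prod_def)

lemma closed_dual_cone: "closed (dual_cone D)"
proof -
  have "dual_cone D = (\<Inter>x\<in>D. {y. x \<bullet> y \<ge> 0})" by (auto simp: dual_cone_def)
  then show ?thesis by (auto intro!: closed_halfspace_ge)
qed

text \<open>
The separating vector points from \<open>p\<close> to its nearest point \<open>a\<close> in the cone; since the cone contains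
the ray through \<open>a\<close>, the vector \<open>a - p\<close> is orthogonal to \<open>a\<close>.
\<close>
lemma separate_point_closed_cone:
  fixes T :: "'a::real_inner set"
  assumes fd: "finite_dimensional TYPE('a)" and T: "convex_cone T" "closed T" and "p \<notin> T"
  obtains q where "q \<in> dual_cone T" "p \<bullet> q < 0"
proof -
  have 0: "0 \<in> T" using T(1) by (simp add: convex_cone_iff)
  have "compact (T \<inter> cball p (dist p 0))"
    using fd T(2) by (intro compact_finite_dimensional) auto
  moreover have "T \<inter> cball p (dist p 0) \<noteq> {}" using 0 by auto
  moreover have "continuous_on (T \<inter> cball p (dist p 0)) (dist p)"
    by (intro continuous_intros)
  ultimately obtain a where a: "a \<in> T \<inter> cball p (dist p 0)"
      "\<forall>z \<in> T \<inter> cball p (dist p 0). dist p a \<le> dist p z"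
    using continuous_attains_inf by blast
  have near: "\<forall>z\<in>T. dist p a \<le> dist p z"
  proof
    fix z assume "z \<in> T"
    with a show "dist p a \<le> dist p z"
      by (cases "dist p z \<le> dist p 0") auto
  qed
  have aT: "a \<in> T" using a by blast
  have "convex T" using T(1) by (simp add: convex_cone_def)
  have dot: "(p - a) \<bullet> (y - a) \<le> 0" if "y \<in> T" for y
    using any_closest_point_dot[OF \<open>convex T\<close> T(2) aT that near] .
  have "2 *\<^sub>R a \<in> T" using aT T(1) by (intro convex_cone_scaleR) auto
  then have "(p - a) \<bullet> a = 0"
    using dot[OF 0] dot[of "2 *\<^sub>R a"] by (simp add: algebra_simps)
  then have orth: "(a - p) \<bullet> a = 0" by (simp add: algebra_simps)
  have "y \<bullet> (a - p) \<ge> 0" if "y \<in> T" for y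
    using dot[OF that] orth by (simp add: inner_commute algebra_simps)
  then have "a - p \<in> dual_cone T" by (simp add: dual_cone_def)
  moreover have "p \<bullet> (a - p) = - ((a - p) \<bullet> (a - p))"
    using orth by (simp add: inner_commute algebra_simps)
  moreover have "(a - p) \<bullet> (a - p) > 0"
    using aT \<open>p \<notin> T\<close> by auto
  ultimately show thesis using that by fastforce
qed

lemma dual_cone_dual_cone:
  fixes C :: "'a::real_inner set"
  assumes fd: "finite_dimensional TYPE('a)" and C: "convex_cone C" "closed C"
  shows "dual_cone (dual_cone C) = C"
proof
  show "C \<subseteq> dual_cone (dual_cone C)" by (auto simp: dual_cone_def inner_commute)
  show "dual_cone (dual_cone C) \<subseteq> C"
  proof
    fix p assume p: "p \<in> dual_cone (dual_cone C)"
    show "p \<in> C"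
    proof (rule ccontr)
      assume "p \<notin> C"
      then obtain q where "q \<in> dual_cone C" "p \<bullet> q < 0"
        using separate_point_closed_cone[OF fd C] by blast
      then show False using p by (force simp: dual_cone_def inner_commute)
    qed
  qed
qed

text \<open>
From a relative interior point \<open>k0\<close> one can move a little away from any \<open>k \<in> K\<close> and stay in \<open>K\<close>; if
\<open>k \<bullet> y\<close> were positive, then \<open>y\<close> would be negative at the point so reached.
\<close>
lemma dual_cone_orthogonal_rel_interior:
  fixes K :: "'a::real_inner set"
  assumes y: "y \<in> dual_cone K" and k0: "k0 \<in> rel_interior K" and orth: "k0 \<bullet> y = 0"
    and k: "k \<in> K"
  shows "k \<bullet> y = 0"
proof (rule ccontr)
  assume "k \<bullet> y \<noteq> 0"
  with y k have pos: "k \<bullet> y > 0" by (force simp: dual_cone_def)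
  obtain e where e: "k0 \<in> K" "e > 0" "cball k0 e \<inter> affine hull K \<subseteq> K"
    using k0 by (auto simp: mem_rel_interior_cball)
  define t where "t = e / (norm (k0 - k) + 1)"
  have t: "t > 0" "t * norm (k0 - k) \<le> e"
    using e(2) by (auto simp: t_def field_simps add_pos_nonneg)
  define p where "p = k0 + t *\<^sub>R (k0 - k)"
  have "p = (1 + t) *\<^sub>R k0 + (- t) *\<^sub>R k" by (simp add: p_def algebra_simps)
  also have "\<dots> \<in> affine hull K"
    using e(1) k by (intro mem_affine[OF affine_affine_hull]) (auto intro: hull_inc)
  finally have "p \<in> K" using e(3) t by (auto simp: p_def dist_norm)
  then have "p \<bullet> y \<ge> 0" using y by (auto simp: dual_cone_def)
  moreover have "p \<bullet> y = - t * (k \<bullet> y)"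
    using orth by (simp add: p_def inner_add_left inner_diff_left)
  ultimately show False using mult_pos_pos[OF t(1) pos] by simp
qed


section \<open>Consequences of the Slater condition\<close>

text \<open>
The cone \<open>P\<close> of slacks serves two purposes: \<open>P = {0}\<close> gives the set whose closedness is claimed, and
\<open>P = {0..}\<close> gives the set from which strong duality is derived. Nonnegativity of the slack is what
allows it to join the sum of nonnegative terms that the Slater point forces to vanish.
\<close>
lemma closed_dual_image:
  fixes C :: "'a::real_inner set" and K :: "'b::real_inner set" and A :: "'a \<Rightarrow> 'b" and b :: 'b
    and P :: "real set"
  assumes fd: "finite_dimensional TYPE('a)" "finite_dimensional TYPE('b)"
    and A: "linear A"
    and slater: "x0 \<in> rel_interior C" "b - A x0 \<in> rel_interior K"
    and P: "convex_cone P" "closed P" "P \<subseteq> {0..}"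
  shows "closed ((\<lambda>(y, w, t). (adjoint A y - w, b \<bullet> y + t)) ` (dual_cone K \<times> dual_cone C \<times> P))"
proof (rule closed_linear_image_cone)
  note adj = inner_adjoint_finite_dimensional[OF fd(1) A]
  note ladj = linear_adjoint_finite_dimensional[OF fd(1) A]
  let ?M = "\<lambda>(y, w, t). (adjoint A y - w, b \<bullet> y + t)"
  let ?N = "dual_cone K \<times> dual_cone C \<times> P"
  show "finite_dimensional TYPE('b \<times> 'a \<times> real)"
    by (intro finite_dimensional_prod finite_dimensional_real fd)
  show "linear ?M"
    by (rule linearI)
      (auto simp: linear_add[OF ladj] linear_cmul[OF ladj] inner_add_right algebra_simps)
  show "convex_cone ?N"
    by (intro convex_cone_Times convex_cone_dual_cone P)
  show "closed ?N"
    by (intro closed_Times closed_dual_cone P)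
  fix v assume "v \<in> ?N" "?M v = 0"
  then obtain y w t where v: "v = (y, w, t)" "y \<in> dual_cone K" "w \<in> dual_cone C" "t \<in> P"
    and eq: "adjoint A y = w" "b \<bullet> y + t = 0"
    by (auto simp: zero_prod_def)
  have in0: "x0 \<in> C" "b - A x0 \<in> K" using slater rel_interior_subset by auto
  have "(b - A x0) \<bullet> y + x0 \<bullet> w + t = 0"
    using eq adj[of x0 y] by (simp add: inner_diff_left)
  moreover have "(b - A x0) \<bullet> y \<ge> 0" "x0 \<bullet> w \<ge> 0" "t \<ge> 0"
    using v in0 P(3) by (auto simp: dual_cone_def)
  ultimately have "(b - A x0) \<bullet> y = 0" "x0 \<bullet> w = 0" "t = 0" by linarith+
  then have "- y \<in> dual_cone K" "- w \<in> dual_cone C"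
    using dual_cone_orthogonal_rel_interior[OF v(2) slater(2)]
      dual_cone_orthogonal_rel_interior[OF v(3) slater(1)]
    by (auto simp: dual_cone_def)
  with v \<open>t = 0\<close> show "- v \<in> ?N" by simp
qed

lemma weak_duality:
  fixes C :: "'a::real_inner set" and K :: "'b::real_inner set"
  assumes fd: "finite_dimensional TYPE('a)" and A: "linear A"
    and x: "x \<in> primal_feasible C K A b" and y: "y \<in> dual_feasible C K A c"
  shows "c \<bullet> x \<le> b \<bullet> y"
proof -
  have "(b - A x) \<bullet> y \<ge> 0" "x \<bullet> (adjoint A y - c) \<ge> 0"
    using x y by (auto simp: primal_feasible_def dual_feasible_def dual_cone_def)
  then show ?thesis
    using inner_adjoint_finite_dimensional[OF fd A, of x y]
    by (simp add: inner_diff_left inner_diff_right inner_commute)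
qed

text \<open>
The Farkas-type core of strong duality. The Slater point enters twice: it makes \<open>T\<close> closed, and in
the case \<open>r = 0\<close> it is the start of a feasible ray along which the objective is unbounded.
\<close>
lemma dual_feasible_attaining_primal_bound:
  fixes C :: "'a::real_inner set" and K :: "'b::real_inner set" and A :: "'a \<Rightarrow> 'b"
  assumes fd: "finite_dimensional TYPE('a)" "finite_dimensional TYPE('b)"
    and C: "convex_cone C" "closed C" and K: "convex_cone K" "closed K"
    and A: "linear A"
    and slater: "x0 \<in> rel_interior C" "b - A x0 \<in> rel_interior K"
    and bound: "\<And>x. x \<in> primal_feasible C K A b \<Longrightarrow> c \<bullet> x \<le> z"
  obtains y where "y \<in> dual_feasible C K A c" "b \<bullet> y \<le> z"
proof -
  note adj = inner_adjoint_finite_dimensional[OF fd(1) A]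
  note ladj = linear_adjoint_finite_dimensional[OF fd(1) A]
  let ?M = "\<lambda>(y, w, t). (adjoint A y - w, b \<bullet> y + t)"
  define T where "T = ?M ` (dual_cone K \<times> dual_cone C \<times> {0..})"
  have halfline: "convex_cone {0::real..}" by (auto simp: convex_cone_iff)
  have "closed T"
    unfolding T_def by (intro closed_dual_image[OF fd A slater] halfline) auto
  have "linear ?M"
    by (rule linearI)
      (auto simp: linear_add[OF ladj] linear_cmul[OF ladj] inner_add_right algebra_simps)
  moreover have "convex_cone (dual_cone K \<times> dual_cone C \<times> {0::real..})"
    by (intro convex_cone_Times convex_cone_dual_cone halfline)
  ultimately have "convex_cone T"
    unfolding T_def by (intro convex_cone_linear_image) auto
  have in0: "x0 \<in> C" "b - A x0 \<in> K" using slater rel_interior_subset by auto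
  have "(c, z) \<in> T"
  proof (rule ccontr)
    assume "(c, z) \<notin> T"
    moreover have "finite_dimensional TYPE('a \<times> real)"
      by (intro finite_dimensional_prod finite_dimensional_real fd)
    ultimately obtain q where q: "q \<in> dual_cone T" "(c, z) \<bullet> q < 0"
      using separate_point_closed_cone \<open>convex_cone T\<close> \<open>closed T\<close> by blast
    obtain x r where xr: "q = (- x, r)" by (metis minus_minus surj_pair)
    \<comment> \<open>Testing the separating vector on the three factors of the cone: \<open>t\<close> gives \<open>r \<ge> 0\<close>, \<open>w\<close> gives
      \<open>x \<in> C\<close>, and \<open>y\<close> gives \<open>r b - A x \<in> K\<close>.\<close>
    have less: "r * z < c \<bullet> x" using q(2) by (simp add: xr mult.commute)
    have ge: "- (x \<bullet> (adjoint A y - w)) + r * (b \<bullet> y + t) \<ge> 0"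
      if "y \<in> dual_cone K" "w \<in> dual_cone C" "t \<ge> 0" for y w t
    proof -
      have "?M (y, w, t) \<in> T" using that unfolding T_def by blast
      with q(1) have "?M (y, w, t) \<bullet> q \<ge> 0" unfolding dual_cone_def by blast
      then show ?thesis by (simp add: xr inner_commute mult.commute)
    qed
    have zero: "0 \<in> dual_cone K" "0 \<in> dual_cone C" by (auto simp: dual_cone_def)
    have r: "r \<ge> 0" using ge[OF zero, of 1] by (simp add: linear_0[OF ladj])
    have "x \<in> dual_cone (dual_cone C)"
      using ge[OF zero(1), of _ 0] by (auto simp: dual_cone_def linear_0[OF ladj] inner_commute)
    then have xC: "x \<in> C" by (simp add: dual_cone_dual_cone fd C)
    have "r *\<^sub>R b - A x \<in> dual_cone (dual_cone K)"
      using ge[OF _ zero(2), of _ 0] adj[of x]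
      by (auto simp: dual_cone_def inner_diff_right inner_diff_left inner_commute)
    then have rK: "r *\<^sub>R b - A x \<in> K" by (simp add: dual_cone_dual_cone fd K)
    \<comment> \<open>One family of feasible points covers both cases: \<open>(s, t) = (1, t)\<close> for \<open>r = 0\<close> and
      \<open>(s, t) = (0, 1 / r)\<close> for \<open>r > 0\<close>.\<close>
    have comb: "s *\<^sub>R x0 + t *\<^sub>R x \<in> primal_feasible C K A b"
      if "s \<ge> 0" "t \<ge> 0" "s + t * r = 1" for s t
    proof -
      have "b - A (s *\<^sub>R x0 + t *\<^sub>R x) = (s + t * r) *\<^sub>R b - A (s *\<^sub>R x0 + t *\<^sub>R x)"
        using that by simp
      also have "\<dots> = s *\<^sub>R (b - A x0) + t *\<^sub>R (r *\<^sub>R b - A x)"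
        by (simp add: linear_add[OF A] linear_cmul[OF A] algebra_simps)
      also have "\<dots> \<in> K"
        using that in0 rK K(1) by (intro convex_cone_add convex_cone_scaleR)
      finally have "b - A (s *\<^sub>R x0 + t *\<^sub>R x) \<in> K" .
      moreover have "s *\<^sub>R x0 + t *\<^sub>R x \<in> C"
        using that in0 xC C(1) by (intro convex_cone_add convex_cone_scaleR)
      ultimately show ?thesis by (simp add: primal_feasible_def)
    qed
    show False
    proof (cases "r = 0")
      case True
      with less have pos: "c \<bullet> x > 0" by simp
      \<comment> \<open>Large enough that the objective gains more than \<open>z - c \<bullet> x0\<close> over its value at \<open>x0\<close>.\<close>
      define t where "t = (\<bar>z - c \<bullet> x0\<bar> + 1) / (c \<bullet> x)"
      have "t \<ge> 0" using pos by (simp add: t_def)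
      then have "c \<bullet> x0 + t * (c \<bullet> x) \<le> z"
        using bound[OF comb[of 1 t]] True by (simp add: inner_add_right)
      moreover have "t * (c \<bullet> x) = \<bar>z - c \<bullet> x0\<bar> + 1" using pos by (simp add: t_def)
      ultimately show False by linarith
    next
      case False
      with r have "r > 0" by simp
      then have "(c \<bullet> x) / r \<le> z"
        using bound[OF comb[of 0 "1 / r"]] by simp
      with less \<open>r > 0\<close> show False by (simp add: field_simps)
    qed
  qed
  then obtain y w t where "y \<in> dual_cone K" "w \<in> dual_cone C" "t \<ge> 0"
    "c = adjoint A y - w" "z = b \<bullet> y + t"
    by (auto simp: T_def)
  then have "y \<in> dual_feasible C K A c" "b \<bullet> y \<le> z"
    by (auto simp: dual_feasible_def)
  then show thesis by (rule that)
qed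

text \<open>
The Slater point is feasible, so the primal value is not \<open>-\<infinity>\<close>; if it is \<open>\<infinity>\<close>, weak duality
settles the equality, and if it is finite, it is itself a primal bound that some dual feasible
point attains.
\<close>
lemma strong_duality_primal_slater:
  fixes C :: "'a::real_inner set" and K :: "'b::real_inner set" and A :: "'a \<Rightarrow> 'b"
  assumes fd: "finite_dimensional TYPE('a)" "finite_dimensional TYPE('b)"
    and C: "convex_cone C" "closed C" and K: "convex_cone K" "closed K"
    and A: "linear A"
    and slater: "x0 \<in> rel_interior C" "b - A x0 \<in> rel_interior K"
  shows "primal_value C K A b c = dual_value C K A b c"
    and "\<bar>primal_value C K A b c\<bar> \<noteq> \<infinity> \<Longrightarrow> \<exists>y. dual_optimal C K A b c y"
proof -
  let ?p = "primal_value C K A b c" and ?d = "dual_value C K A b c"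
  have weak: "?p \<le> ?d"
    unfolding primal_value_def dual_value_def
    by (intro SUP_least INF_greatest) (simp add: weak_duality[OF fd(1) A])
  have up: "ereal (c \<bullet> x) \<le> ?p" if "x \<in> primal_feasible C K A b" for x
    unfolding primal_value_def using that by (rule SUP_upper)
  have down: "?d \<le> ereal (b \<bullet> y)" if "y \<in> dual_feasible C K A c" for y
    unfolding dual_value_def using that by (rule INF_lower)
  have "x0 \<in> C" "b - A x0 \<in> K" using slater rel_interior_subset by auto
  then have "x0 \<in> primal_feasible C K A b" by (simp add: primal_feasible_def)
  then have "?p \<noteq> - \<infinity>" using up[of x0] by auto
  have att: "\<exists>y \<in> dual_feasible C K A c. b \<bullet> y \<le> z" if "?p = ereal z" for z
    using dual_feasible_attaining_primal_bound[OF fd C K A slater, of c z] up that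
    by (metis ereal_less_eq(3))
  show eq: "?p = ?d"
  proof (cases ?p)
    case (real z)
    with att down show ?thesis
      using weak by (metis antisym ereal_less_eq(3) order_trans)
  qed (use weak \<open>?p \<noteq> - \<infinity>\<close> in auto)
  show "\<exists>y. dual_optimal C K A b c y" if "\<bar>?p\<bar> \<noteq> \<infinity>"
  proof -
    obtain z where z: "?p = ereal z" using \<open>\<bar>?p\<bar> \<noteq> \<infinity>\<close> by auto
    then obtain y where "y \<in> dual_feasible C K A c" "b \<bullet> y \<le> z" using att by blast
    moreover have "z \<le> b \<bullet> y'" if "y' \<in> dual_feasible C K A c" for y'
      using down[OF that] by (simp flip: eq add: z)
    ultimately show ?thesis unfolding dual_optimal_def by force
  qed
qed


section \<open>Exchanging the primal and the dual program\<close>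

text \<open>
Duality is an involution up to sign: by the bipolar theorem and \<open>adjoint A' = - A\<close>, the dual of the
swapped program is the original primal. The signs turn its supremum and infimum into each other.
\<close>
lemma swap_primal_dual:
  fixes C :: "'a::real_inner set" and K :: "'b::real_inner set" and A :: "'a \<Rightarrow> 'b"
  assumes fd: "finite_dimensional TYPE('a)" "finite_dimensional TYPE('b)"
    and C: "convex_cone C" "closed C" and K: "convex_cone K" "closed K"
    and A: "linear A"
  defines "A' \<equiv> \<lambda>y. - adjoint A y"
  shows "linear A'" and "adjoint A' = (\<lambda>x. - A x)"
    and "primal_feasible (dual_cone K) (dual_cone C) A' (- c) = dual_feasible C K A c"
    and "dual_feasible (dual_cone K) (dual_cone C) A' (- b) = primal_feasible C K A b"
    and "primal_value (dual_cone K) (dual_cone C) A' (- c) (- b) = - dual_value C K A b c"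
    and "dual_value (dual_cone K) (dual_cone C) A' (- c) (- b) = - primal_value C K A b c"
    and "dual_optimal (dual_cone K) (dual_cone C) A' (- c) (- b) = primal_optimal C K A b c"
proof -
  show "linear A'"
    unfolding A'_def by (intro linear_compose_neg linear_adjoint_finite_dimensional fd A)
  show adj: "adjoint A' = (\<lambda>x. - A x)"
    unfolding A'_def
    by (intro adjoint_unique) (metis inner_adjoint_finite_dimensional[OF fd(1) A] inner_commute
        inner_minus_right)
  show p: "primal_feasible (dual_cone K) (dual_cone C) A' (- c) = dual_feasible C K A c"
    by (auto simp: primal_feasible_def dual_feasible_def A'_def)
  show d: "dual_feasible (dual_cone K) (dual_cone C) A' (- b) = primal_feasible C K A b"
    using dual_cone_dual_cone[OF fd(1) C] dual_cone_dual_cone[OF fd(2) K]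
    by (auto simp: primal_feasible_def dual_feasible_def adj)
  show "primal_value (dual_cone K) (dual_cone C) A' (- c) (- b) = - dual_value C K A b c"
    unfolding primal_value_def dual_value_def p by (simp flip: ereal_SUP_uminus_eq)
  show "dual_value (dual_cone K) (dual_cone C) A' (- c) (- b) = - primal_value C K A b c"
    unfolding primal_value_def dual_value_def d by (simp flip: ereal_INF_uminus_eq)
  show "dual_optimal (dual_cone K) (dual_cone C) A' (- c) (- b) = primal_optimal C K A b c"
    by (auto simp: fun_eq_iff dual_optimal_def primal_optimal_def d)
qed

theorem proposition2:
  fixes C :: "'a::real_inner set" and K :: "'b::real_inner set"
    and A :: "'a \<Rightarrow> 'b" and b :: 'b and c :: 'a
  assumes "finite_dimensional TYPE('a)" and "finite_dimensional TYPE('b)"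
    and "C \<noteq> {}" and "closed C" and "convex C" and "cone C"
    and "K \<noteq> {}" and "closed K" and "convex K" and "cone K"
    and "C \<noteq> {0}" and "C \<noteq> UNIV \<or> K \<noteq> UNIV"
    and "linear A"
  shows "((\<exists>x\<in>rel_interior C. b - A x \<in> rel_interior K) \<longrightarrow>
           closed {(adjoint A y - w, b \<bullet> y) | y w. y \<in> dual_cone K \<and> w \<in> dual_cone C} \<and>
           strong_duality C K A b c) \<and>
         ((\<exists>y\<in>rel_interior (dual_cone K). adjoint A y - c \<in> rel_interior (dual_cone C)) \<longrightarrow>
           closed {(A x + s, c \<bullet> x) | x s. x \<in> C \<and> s \<in> K} \<and>
           strong_duality C K A b c)"
proof (intro conjI[where P = "_ \<longrightarrow> _"] impI)
  note fd = assms(1,2) and A = \<open>linear A\<close>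
  have C: "convex_cone C" "closed C" and K: "convex_cone K" "closed K"
    using assms by (auto simp: convex_cone_def conic_def cone_def)
  have trivial: "convex_cone {0::real}" by (auto simp: convex_cone_iff)
  {
    assume "\<exists>x\<in>rel_interior C. b - A x \<in> rel_interior K"
    then obtain x0 where slater: "x0 \<in> rel_interior C" "b - A x0 \<in> rel_interior K" by blast
    have "{(adjoint A y - w, b \<bullet> y) | y w. y \<in> dual_cone K \<and> w \<in> dual_cone C}
        = (\<lambda>(y, w, t). (adjoint A y - w, b \<bullet> y + t)) ` (dual_cone K \<times> dual_cone C \<times> {0})"
      by force
    then show "closed {(adjoint A y - w, b \<bullet> y) | y w. y \<in> dual_cone K \<and> w \<in> dual_cone C} \<and>
        strong_duality C K A b c"
      using closed_dual_image[OF fd A slater trivial] strong_duality_primal_slater[OF fd C K A slater]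
      by (simp add: strong_duality_def)
  next
    assume "\<exists>y\<in>rel_interior (dual_cone K). adjoint A y - c \<in> rel_interior (dual_cone C)"
    then obtain y0 where y0: "y0 \<in> rel_interior (dual_cone K)"
      "adjoint A y0 - c \<in> rel_interior (dual_cone C)" by blast
    define A' where "A' y = - adjoint A y" for y
    note swap = swap_primal_dual[OF fd C K A, folded A'_def]
    have slater: "- c - A' y0 \<in> rel_interior (dual_cone C)" using y0(2) by (simp add: A'_def)
    \<comment> \<open>The image set of the swapped program is the negative of the one wanted.\<close>
    have "{(A x + s, c \<bullet> x) | x s. x \<in> C \<and> s \<in> K}
        = uminus ` (\<lambda>(x, s, t). (adjoint A' x - s, - c \<bullet> x + t)) `
            (dual_cone (dual_cone C) \<times> dual_cone (dual_cone K) \<times> {0})"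
      unfolding swap(2) dual_cone_dual_cone[OF fd(1) C] dual_cone_dual_cone[OF fd(2) K]
      by (force simp: image_image)
    moreover have "closed \<dots>"
      using closed_dual_image[OF fd(2,1) swap(1) y0(1) slater trivial]
      by (intro closed_negations) auto
    ultimately have "closed {(A x + s, c \<bullet> x) | x s. x \<in> C \<and> s \<in> K}" by simp
    moreover have "strong_duality C K A b c"
      using strong_duality_primal_slater[OF fd(2,1) convex_cone_dual_cone closed_dual_cone
          convex_cone_dual_cone closed_dual_cone swap(1) y0(1) slater, of "- b"]
      unfolding swap strong_duality_def by auto
    ultimately show "closed {(A x + s, c \<bullet> x) | x s. x \<in> C \<and> s \<in> K} \<and> strong_duality C K A b c"
      by blast
  }
qed

end
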